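(* For every integer $n\ge 0$, $$G_n=\sum_{k=0}^n \binom{n}{k}(-1)^k\binom{2k}{k}^2 16^{n-k}.$$
   Context: For $n=0,1,2,\dots$ define $G_n=\sum_{k=0}^n \binom{2k}{k}^2\binom{2n-2k}{n-k}4^{n-k}$. *)

theory Defs
  imports Complex_Main
begin

(* The natural-number subtractions never truncate, since k ranges over 0..n. *)
definition G :: "nat \<Rightarrow> int" where
  "G n = (\<Sum>k=0..n. int ((2 * k) choose k) ^ 2 * int ((2 * n - 2 * k) choose (n - k)) * 4 ^ (n - k))"

end

(* Let b k be the generalised binomial coefficient (-1/2 choose k), so that
   (2k choose k) = (-4)^k b k.  After division by 16^n the claim is the coefficient form of
   Pfaff's transformation of 2F1(1/2, 1/2; 1; z).  Expanding one factor b m of the left-hand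
   side as (-1)^m b m = (m - 1/2 choose m) = sum_k b k (m choose k) and using
   b m (m choose k) = b k (-1/2 - k choose m - k), the summation over m becomes a second
   Vandermonde convolution, with value (-1 - k choose n - k) = (-1)^(n-k) (n choose k). *)
theory Submission
  imports Defs "HOL-Computational_Algebra.Formal_Power_Series"
begin

text \<open>The duplication formula for \<open>fact (2 * k)\<close> leaves
  \<open>pochhammer (1/2) k / fact k\<close>, which is \<open>(-1) ^ k\<close> times the generalised
  binomial coefficient.\<close>

lemma central_binomial_gbinomial:
  "of_nat ((2 * k) choose k) = (-4) ^ k * ((-1/2 :: 'a :: field_char_0) gchoose k)"
proof -
  have "(of_nat ((2 * k) choose k) :: 'a) = fact (2 * k) / (fact k * fact k)"
    by (simp add: binomial_fact mult_2)
  also have "fact (2 * k) = 4 ^ k * pochhammer (1/2 :: 'a) k * fact k"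
    by (simp add: fact_double power_mult)
  finally have "(of_nat ((2 * k) choose k) :: 'a) = 4 ^ k * pochhammer (1/2) k / fact k"
    by simp
  also have "\<dots> = (-4) ^ k * ((-1/2) gchoose k)"
    by (simp add: gbinomial_pochhammer flip: power_mult_distrib)
  finally show ?thesis .
qed

lemma gbinomial_of_nat_diff:
  "k \<le> n \<Longrightarrow> (of_nat n gchoose (n - k) :: 'a :: field_char_0) = of_nat (n choose k)"
  by (metis binomial_gbinomial binomial_symmetric)

text \<open>Upper negation turns the left side into a coefficient with upper argument
  \<open>m - 1/2\<close>, which Vandermonde splits as \<open>m\<close> plus
  \<open>-1/2\<close>.\<close>

lemma gbinomial_minus_half_expansion:
  "(-1) ^ m * ((-1/2 :: 'a :: field_char_0) gchoose m)
     = (\<Sum>k=0..m. ((-1/2) gchoose k) * of_nat (m choose k))"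
proof -
  have "(-1) ^ m * ((-1/2 :: 'a) gchoose m) = (of_nat m + (-1/2) :: 'a) gchoose m"
    using gbinomial_negated_upper[of "of_nat m + (-1/2) :: 'a" m] by simp
  also have "\<dots> = (\<Sum>k=0..m. ((-1/2) gchoose k) * (of_nat m gchoose (m - k)))"
    using gbinomial_Vandermonde[of "-1/2 :: 'a" "of_nat m" m] by (simp add: add.commute)
  also have "\<dots> = (\<Sum>k=0..m. ((-1/2) gchoose k) * of_nat (m choose k))"
    by (intro sum.cong refl) (simp add: gbinomial_of_nat_diff)
  finally show ?thesis .
qed

lemma gbinomial_minus_half_convolution:
  assumes "k \<le> n"
  shows "(\<Sum>m=k..n. ((-1/2 :: 'a :: field_char_0) gchoose (n - m))
            * ((-1/2) gchoose m) * of_nat (m choose k))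
         = (-1) ^ (n - k) * ((-1/2) gchoose k) * of_nat (n choose k)"
proof -
  let ?b = "\<lambda>j. (-1/2 :: 'a) gchoose j"
  have "(\<Sum>m=k..n. ?b (n - m) * ?b m * of_nat (m choose k))
      = (\<Sum>m=k..n. ?b k * ((-1/2 - of_nat k gchoose (m - k)) * ?b (n - m)))"
  proof (intro sum.cong refl)
    fix m assume "m \<in> {k..n}"
    \<comment> \<open>Trinomial revision: the only factor left outside the convolution,
      \<open>?b k\<close>, does not depend on \<open>m\<close>.\<close>
    then have "?b m * of_nat (m choose k) = ?b k * (-1/2 - of_nat k gchoose (m - k))"
      using gbinomial_trinomial_revision[of k m "-1/2 :: 'a"] by (simp add: binomial_gbinomial)
    then show "?b (n - m) * ?b m * of_nat (m choose k)
        = ?b k * ((-1/2 - of_nat k gchoose (m - k)) * ?b (n - m))"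
      by (simp add: mult_ac)
  qed
  also have "\<dots> = ?b k * (\<Sum>i=0..n-k. (-1/2 - of_nat k gchoose i) * ?b (n - k - i))"
    unfolding sum_distrib_left
    by (rule sum.reindex_bij_witness[of _ "\<lambda>i. i + k" "\<lambda>m. m - k"]) (use assms in auto)
  \<comment> \<open>The upper arguments \<open>-1/2 - k\<close> and \<open>-1/2\<close> add up to
    the integer \<open>-1 - k\<close>, so upper negation can then reach an ordinary binomial
    coefficient.\<close>
  also have "\<dots> = ?b k * ((-1 - of_nat k) gchoose (n - k))"
    unfolding gbinomial_Vandermonde by simp
  also have "(-1 - of_nat k :: 'a) gchoose (n - k) = (-1) ^ (n - k) * (of_nat n gchoose (n - k))"
    using assms gbinomial_negated_upper[of "-1 - of_nat k :: 'a" "n - k"]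
    by (simp add: of_nat_diff)
  also have "(of_nat n gchoose (n - k) :: 'a) = of_nat (n choose k)"
    using assms by (rule gbinomial_of_nat_diff)
  finally show ?thesis by (simp add: mult_ac)
qed

text \<open>Let F(z) be the series with coefficients \<open>((-1/2) gchoose k) ^ 2\<close>. The two
  sides are the coefficients of z^n in (1-z)^(-1/2) F(z) and (1-z)^(-1) F(z/(z-1)).\<close>

lemma gbinomial_minus_half_pfaff:
  "(\<Sum>m=0..n. ((-1/2 :: 'a :: field_char_0) gchoose m) ^ 2
       * ((-1) ^ (n - m) * ((-1/2) gchoose (n - m))))
   = (\<Sum>k=0..n. of_nat (n choose k) * (-1) ^ k * ((-1/2) gchoose k) ^ 2)"
proof -
  let ?b = "\<lambda>j. (-1/2 :: 'a) gchoose j"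
  have sgn: "(-1 :: 'a) ^ (n - m) = (-1) ^ n * (-1) ^ m" if "m \<le> n" for m
    using that by (simp add: minus_one_power_iff)
  \<comment> \<open>One factor \<open>?b m\<close> is grouped with \<open>(-1) ^ m\<close> for the
    expansion; the other is kept for the convolution.\<close>
  have "(\<Sum>m=0..n. ?b m ^ 2 * ((-1) ^ (n - m) * ?b (n - m)))
      = (\<Sum>m=0..n. (-1) ^ n * (?b (n - m) * ?b m * ((-1) ^ m * ?b m)))"
    by (intro sum.cong refl) (simp add: sgn power2_eq_square mult_ac)
  also have "\<dots> = (\<Sum>m=0..n. \<Sum>k=0..m.
        (-1) ^ n * ?b k * (?b (n - m) * ?b m * of_nat (m choose k)))"
    unfolding gbinomial_minus_half_expansion sum_distrib_left by (simp add: mult_ac)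
  \<comment> \<open>Interchange of summation over the triangle k \<le> m \<le> n.\<close>
  also have "\<dots> = (\<Sum>k=0..n. \<Sum>m=k..n.
        (-1) ^ n * ?b k * (?b (n - m) * ?b m * of_nat (m choose k)))"
    unfolding sum.Sigma[OF finite_atLeastAtMost ballI[OF finite_atLeastAtMost]]
    by (rule sum.reindex_bij_witness[of _ prod.swap prod.swap]) auto
  also have "\<dots> = (\<Sum>k=0..n. (-1) ^ n * ?b k * ((-1) ^ (n - k) * ?b k * of_nat (n choose k)))"
    by (intro sum.cong refl)
       (simp only: gbinomial_minus_half_convolution atLeastAtMost_iff flip: sum_distrib_left)
  also have "\<dots> = (\<Sum>k=0..n. of_nat (n choose k) * (-1) ^ k * ?b k ^ 2)"
    by (intro sum.cong refl) (simp add: sgn power2_eq_square mult_ac)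
  finally show ?thesis .
qed

theorem theorem2p1:
  fixes n :: nat
  shows "G n = (\<Sum>k=0..n. int (n choose k) * (-1) ^ k * int ((2 * k) choose k) ^ 2 * 16 ^ (n - k))"
proof -
  \<comment> \<open>The coefficients \<open>?b j\<close> are not integers in general, so the
    identity is proved in the reals and pulled back along the injective
    \<open>of_int\<close>.\<close>
  let ?b = "\<lambda>j. (-1/2 :: real) gchoose j"
  have square: "of_nat ((2 * k) choose k) ^ 2 = 16 ^ k * ?b k ^ 2" for k
    unfolding central_binomial_gbinomial power2_eq_square
    by (simp add: mult_ac flip: power_mult_distrib)
  have pow16: "(16 :: real) ^ n = 16 ^ k * 16 ^ (n - k)" if "k \<le> n" for k
    using that by (simp flip: power_add)
  have "of_int (G n) = (\<Sum>k=0..n. of_nat ((2 * k) choose k) ^ 2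
      * of_nat ((2 * (n - k)) choose (n - k)) * (4 :: real) ^ (n - k))"
    by (simp add: G_def diff_mult_distrib2)
  also have "\<dots> = (\<Sum>k=0..n. 16 ^ n * (?b k ^ 2 * ((-1) ^ (n - k) * ?b (n - k))))"
  proof (intro sum.cong refl)
    fix k assume "k \<in> {0..n}"
    \<comment> \<open>The power of -4 comes from the unsquared central binomial coefficient, the
      power of 4 from the definition of \<open>G\<close>.\<close>
    moreover have "(-4 :: real) ^ (n - k) * 4 ^ (n - k) = 16 ^ (n - k) * (-1) ^ (n - k)"
      by (simp flip: power_mult_distrib)
    ultimately show "of_nat ((2 * k) choose k) ^ 2
        * of_nat ((2 * (n - k)) choose (n - k)) * (4 :: real) ^ (n - k)
        = 16 ^ n * (?b k ^ 2 * ((-1) ^ (n - k) * ?b (n - k)))"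
      unfolding square by (simp add: central_binomial_gbinomial pow16[of k])
  qed
  also have "\<dots> = (\<Sum>k=0..n. 16 ^ n * (of_nat (n choose k) * (-1) ^ k * ?b k ^ 2))"
    by (simp only: gbinomial_minus_half_pfaff flip: sum_distrib_left)
  also have "\<dots> = (\<Sum>k=0..n. of_nat (n choose k) * (-1) ^ k
      * of_nat ((2 * k) choose k) ^ 2 * 16 ^ (n - k))"
  proof (intro sum.cong refl)
    fix k assume "k \<in> {0..n}"
    then show "16 ^ n * (of_nat (n choose k) * (-1) ^ k * ?b k ^ 2)
        = of_nat (n choose k) * (-1) ^ k * of_nat ((2 * k) choose k) ^ 2 * 16 ^ (n - k)"
      unfolding square by (simp add: pow16[of k])
  qed
  also have "\<dots> = of_int (\<Sum>k=0..n. int (n choose k) * (-1) ^ k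
      * int ((2 * k) choose k) ^ 2 * 16 ^ (n - k))"
    by simp
  finally show ?thesis
    by (simp only: of_int_eq_iff)
qed

end
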